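(* Let $P$ be a metrical task system whose metric space has diameter $D$, and let $A$ be a randomized $\alpha$-competitive online algorithm for $P$. For any $\epsilon\le 1/4$, there is a randomized prediction-based online algorithm for $P$ whose expected cost on every input is below \[(1+\epsilon)\cdot\min\{\alpha,\;1+4\eta/\textsc{Off}\}\cdot\textsc{Off}+O(D/\epsilon),\] where $\textsc{Off}$ is any offline algorithm (and also denotes its cost on the input) and $\eta$ is the prediction error with respect to $\textsc{Off}$.
   Context: A metrical task system (MTS) is given by a metric space $(M,\mathit{dist})$ of states and an initial state $x_0\in M$. At each time $t=1,\dots,T$ a cost function $\ell_t\colon M\to\mathbb{R}_{\ge0}\cup\{+\infty\}$ arrives; the algorithm, without knowledge of future cost functions (but after seeing $\ell_t$), chooses a state $x_t$ and pays $\mathit{dist}(x_{t-1},x_t)+\ell_t(x_t)$; the goal is to minimize total cost. A prediction-based algorithm additionally receives at each time $t$ a predicted state $p_t\in M$. For an offline algorithm $\textsc{Off}$ with states $o_1,\dots,o_T$, the prediction error is $\eta=\sum_{t=1}^T\mathit{dist}(p_t,o_t)$. A randomized online algorithm is $\alpha$-competitive if there is a constant $c$ such that for every input its expected cost is at most $\alpha$ times the optimal offline cost plus $c$. *)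

theory Defs
  imports "HOL-Analysis.Analysis" "HOL-Probability.Probability_Mass_Function"
begin

text \<open>
  The state space is a carrier set \<open>M\<close> with a distance \<open>d\<close>, rather than a type of class
  \<open>metric_space\<close>, so that a constant can be quantified before the metric space.
\<close>

locale metrical_task_system = Metric_space M d for M :: "'a set" and d +
  fixes x0 :: 'a
  assumes initial_state: "x0 \<in> M"

definition mts_diameter :: "'a set \<Rightarrow> ('a \<Rightarrow> 'a \<Rightarrow> real) \<Rightarrow> real" where
  "mts_diameter M d = (SUP (x, y) \<in> M \<times> M. d x y)"

text \<open>
  A cost sequence \<open>\<ell>\<^sub>1, \<dots>, \<ell>\<^sub>T\<close> is a list of extensional functions: they represent exactly the functions
  from \<open>M\<close> to \<open>[0, \<infinity>]\<close>, and an algorithm gets no information from values outside \<open>M\<close>.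
\<close>

definition cost_sequences :: "'a set \<Rightarrow> ('a \<Rightarrow> ennreal) list set" where
  "cost_sequences M = lists (M \<rightarrow>\<^sub>E UNIV)"

definition state_sequences :: "'a set \<Rightarrow> nat \<Rightarrow> 'a list set" where
  "state_sequences M T = {xs \<in> lists M. length xs = T}"

text \<open>
  Lists are indexed from 0: \<open>xs ! t\<close> is the state after serving \<open>ls ! t\<close>, and \<open>(x0 # xs) ! t\<close> is the
  state before it.
\<close>

definition mts_cost ::
  "('a \<Rightarrow> 'a \<Rightarrow> real) \<Rightarrow> 'a \<Rightarrow> ('a \<Rightarrow> ennreal) list \<Rightarrow> 'a list \<Rightarrow> ennreal" where
  "mts_cost d x0 ls xs =
     (\<Sum>t<length ls. ennreal (d ((x0 # xs) ! t) (xs ! t)) + (ls ! t) (xs ! t))"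

definition offline_opt ::
  "'a set \<Rightarrow> ('a \<Rightarrow> 'a \<Rightarrow> real) \<Rightarrow> 'a \<Rightarrow> ('a \<Rightarrow> ennreal) list \<Rightarrow> ennreal" where
  "offline_opt M d x0 ls = (INF xs \<in> state_sequences M (length ls). mts_cost d x0 ls xs)"

text \<open>
  A randomized online algorithm maps the requests received so far (including the current one) and the
  states it has chosen so far to the distribution of its next state.  A request is a cost function
  for a plain algorithm, and a pair of a cost function and a predicted state for a
  prediction-based one.  Since an algorithm recalls its own states, sampling
  afresh at each step realizes the same laws of state sequences as private memory or an initial
  random seed.  Distributions are discrete because cost functions are arbitrary, so that the chosen
  states have to be random variables with respect to all subsets of \<open>M\<close>.
\<close>

type_synonym ('r, 'a) randomized_algorithm = "'r list \<Rightarrow> 'a list \<Rightarrow> 'a pmf"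

definition online_algorithm :: "'a set \<Rightarrow> ('r, 'a) randomized_algorithm \<Rightarrow> bool" where
  "online_algorithm M A \<longleftrightarrow> (\<forall>rs xs. set_pmf (A rs xs) \<subseteq> M)"

primrec run_prefix :: "('r, 'a) randomized_algorithm \<Rightarrow> 'r list \<Rightarrow> nat \<Rightarrow> 'a list pmf" where
  "run_prefix A rs 0 = return_pmf []"
| "run_prefix A rs (Suc t) =
     bind_pmf (run_prefix A rs t) (\<lambda>xs. map_pmf (\<lambda>x. xs @ [x]) (A (take (Suc t) rs) xs))"

definition run :: "('r, 'a) randomized_algorithm \<Rightarrow> 'r list \<Rightarrow> 'a list pmf" where
  "run A rs = run_prefix A rs (length rs)"

definition expected_cost ::
  "('a \<Rightarrow> 'a \<Rightarrow> real) \<Rightarrow> 'a \<Rightarrow> ('a \<Rightarrow> ennreal) list \<Rightarrow> 'a list pmf \<Rightarrow> ennreal" where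
  "expected_cost d x0 ls R = (\<integral>\<^sup>+ xs. mts_cost d x0 ls xs \<partial>measure_pmf R)"

definition competitive_with_constant ::
  "'a set \<Rightarrow> ('a \<Rightarrow> 'a \<Rightarrow> real) \<Rightarrow> 'a \<Rightarrow> ('a \<Rightarrow> ennreal, 'a) randomized_algorithm
    \<Rightarrow> real \<Rightarrow> real \<Rightarrow> bool" where
  "competitive_with_constant M d x0 A \<alpha> c \<longleftrightarrow>
     (\<forall>ls \<in> cost_sequences M.
        expected_cost d x0 ls (run A ls) \<le> ennreal \<alpha> * offline_opt M d x0 ls + ennreal c)"

definition prediction_error :: "('a \<Rightarrow> 'a \<Rightarrow> real) \<Rightarrow> 'a list \<Rightarrow> 'a list \<Rightarrow> real" where
  "prediction_error d ps os = (\<Sum>t<length ps. d (ps ! t) (os ! t))"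

text \<open>
  The expression \<open>(1 + \<epsilon>) \<sqdot> min {\<alpha>, 1 + 4\<eta> / Off} \<sqdot> Off\<close> in \<open>[0, \<infinity>]\<close>.  If \<open>Off = 0\<close> it is
  \<open>0\<close>; if \<open>Off = \<infinity>\<close> it is \<open>\<infinity>\<close> (for \<open>\<alpha> > 0\<close>), so an infeasible \<open>Off\<close> gives no information.
\<close>

definition robust_bound :: "real \<Rightarrow> real \<Rightarrow> real \<Rightarrow> ennreal \<Rightarrow> ennreal" where
  "robust_bound \<epsilon> \<alpha> \<eta> Off =
     ennreal (1 + \<epsilon>) * min (ennreal \<alpha>) (1 + ennreal (4 * \<eta>) / Off) * Off"

end

theory Submission
  imports Defs
begin

text \<open>
  Let \<open>F\<close> move at time \<open>t\<close> to an almost minimizer of \<open>\<ell>\<^sub>t(x) + 2 dist(x, p\<^sub>t)\<close>, with slack \<open>D / 2\<^sup>t\<close>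
  because the infimum need not be attained.  With the potential \<open>dist(f\<^sub>t, o\<^sub>t)\<close> its cost is at most
  \<open>Off + 4\<eta> + D\<close>.

  The algorithm mixes \<open>A\<close> and \<open>F\<close>: it follows \<open>A\<close> with probability \<open>q = u / (u + v)\<close>, where
  \<open>u = exp (- \<epsilon> C\<^sub>A / D)\<close>, \<open>v = exp (- \<epsilon> C\<^sub>F / D)\<close>, and \<open>C\<^sub>A\<close>, \<open>C\<^sub>F\<close> are the (expected) costs of \<open>A\<close> and \<open>F\<close> so
  far.  In each step both \<open>\<bar>\<Delta>q\<bar>\<close> and \<open>\<epsilon> / D\<close> times the \<open>q\<close>-average of the two costs are at most the
  decrease of \<open>ln (u + v)\<close>, so that telescoping bounds the total cost, switching included, by
  \<open>(1 + \<epsilon>) (min {C\<^sub>A, C\<^sub>F} + D ln 2 / \<epsilon>)\<close>.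
\<close>

section \<open>Laws of runs and their truncations\<close>

lemma set_run_prefix_length:
  "xs \<in> set_pmf (run_prefix A rs t) \<Longrightarrow> length xs = t"
  by (induction t arbitrary: xs) auto

lemma set_run_prefix_subset:
  "online_algorithm M A \<Longrightarrow> xs \<in> set_pmf (run_prefix A rs t) \<Longrightarrow> set xs \<subseteq> M"
  by (induction t arbitrary: xs) (auto simp: online_algorithm_def, blast+)

lemma run_prefix_cong:
  "take t rs = take t rs' \<Longrightarrow> run_prefix A rs t = run_prefix A rs' t"
proof (induction t)
  case (Suc t)
  then have "take t rs = take t rs'"
    by (metis Suc_n_not_le_n nat_le_linear min.absorb1 take_take)
  with Suc show ?case by simp
qed simp

lemma run_take: "t \<le> length rs \<Longrightarrow> run A (take t rs) = run_prefix A rs t"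
  unfolding run_def by (simp add: min_absorb2) (rule run_prefix_cong, simp)

lemma run_snoc:
  "run A (rs @ [r]) = bind_pmf (run A rs) (\<lambda>xs. map_pmf (\<lambda>x. xs @ [x]) (A (rs @ [r]) xs))"
proof -
  have "run_prefix A (rs @ [r]) (length rs) = run_prefix A rs (length rs)"
    by (rule run_prefix_cong) simp
  then show ?thesis by (simp add: run_def)
qed

text \<open>A later state never changes the law of the earlier ones. In this form the fact is the
  consistency hypothesis of \<open>online_algorithm_of_consistent_laws\<close>.\<close>

lemma map_butlast_run: "map_pmf butlast (run A (rs @ [r])) = run A rs"
  by (simp add: run_snoc map_bind_pmf pmf.map_comp o_def map_pmf_const bind_return_pmf')

lemma map_take_run_prefix:
  "s \<le> t \<Longrightarrow> map_pmf (take s) (run_prefix A rs t) = run_prefix A rs s"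
proof (induction t rule: dec_induct)
  case base
  show ?case by (rule map_pmf_idI) (auto dest: set_run_prefix_length)
next
  case (step t)
  have "map_pmf (take s) (run_prefix A rs (Suc t)) =
      bind_pmf (run_prefix A rs t) (\<lambda>xs. return_pmf (take s xs))"
    unfolding run_prefix.simps map_bind_pmf pmf.map_comp
  proof (rule bind_pmf_cong[OF refl])
    fix xs assume "xs \<in> set_pmf (run_prefix A rs t)"
    then have "take s \<circ> (\<lambda>x. xs @ [x]) = (\<lambda>_. take s xs)"
      using step.hyps by (auto simp: fun_eq_iff dest: set_run_prefix_length)
    then show "map_pmf (take s \<circ> (\<lambda>x. xs @ [x])) (A (take (Suc t) rs) xs) = return_pmf (take s xs)"
      by (simp add: map_pmf_const)
  qed
  with step.IH show ?case by (simp add: map_pmf_def)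
qed

lemma map_take_run:
  assumes "t \<le> length rs"
  shows "map_pmf (take t) (run A rs) = run A (take t rs)"
  unfolding run_take[OF assms] unfolding run_def by (rule map_take_run_prefix[OF assms])

section \<open>Turning consistent laws of state sequences into an online algorithm\<close>

text \<open>
  Kuhn's theorem on behavioural strategies: the next state is drawn from its conditional
  distribution given the states chosen so far.
\<close>

lemma online_algorithm_of_consistent_laws:
  fixes Q :: "'r list \<Rightarrow> 'a list pmf"
  assumes len: "\<And>rs xs. xs \<in> set_pmf (Q rs) \<Longrightarrow> length xs = length rs"
    and consistent: "\<And>rs r. map_pmf butlast (Q (rs @ [r])) = Q rs"
    and states: "\<And>rs xs. xs \<in> set_pmf (Q rs) \<Longrightarrow> set xs \<subseteq> M"
    and "x0 \<in> M"
  obtains B where "online_algorithm M B" "\<And>rs. run B rs = Q rs"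
proof -
  \<comment> \<open>A history of probability 0 has no conditional law, and an empty request list has
    no last state; the default \<open>x0\<close> keeps the values of \<open>B\<close> inside
    \<open>M\<close> in these cases.\<close>
  define B where "B rs xs =
    (if set_pmf (Q rs) \<inter> {ys. butlast ys = xs} = {} \<or> rs = [] then return_pmf x0
     else map_pmf last (cond_pmf (Q rs) {ys. butlast ys = xs}))" for rs xs
  have "online_algorithm M B"
    unfolding online_algorithm_def
  proof (intro allI)
    fix rs xs
    have "last ys \<in> M" if "ys \<in> set_pmf (Q rs)" "rs \<noteq> []" for ys
      using states[OF that(1)] len[OF that(1)] that(2)
      by (metis last_in_set length_0_conv subsetD)
    then show "set_pmf (B rs xs) \<subseteq> M"
      using \<open>x0 \<in> M\<close> by (auto simp: B_def)
  qed
  moreover have "run B rs = Q rs" for rs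
  proof (induction rs rule: rev_induct)
    case Nil
    have "set_pmf (Q []) \<subseteq> {[]}" using len[of _ "[]"] by auto
    then have "Q [] = return_pmf []" by (simp add: set_pmf_subset_singleton)
    then show ?case by (simp add: run_def)
  next
    case (snoc r rs)
    let ?Q = "Q (rs @ [r])"
    let ?C = "\<lambda>xs. cond_pmf ?Q {ys. butlast ys = xs}"
    have supp: "set_pmf (Q rs) = butlast ` set_pmf ?Q"
      by (metis consistent set_map_pmf)
    have ne: "set_pmf ?Q \<inter> {ys. butlast ys = xs} \<noteq> {}" if "xs \<in> set_pmf (Q rs)" for xs
      using that supp by auto
    have "run B (rs @ [r]) = bind_pmf (Q rs) (\<lambda>xs. map_pmf (\<lambda>x. xs @ [x]) (B (rs @ [r]) xs))"
      by (simp add: run_snoc snoc.IH)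
    also have "\<dots> = bind_pmf (Q rs) ?C"
    proof (rule bind_pmf_cong[OF refl])
      fix xs assume xs: "xs \<in> set_pmf (Q rs)"
      have "map_pmf (\<lambda>x. xs @ [x]) (B (rs @ [r]) xs) = map_pmf (\<lambda>ys. xs @ [last ys]) (?C xs)"
        using ne[OF xs] by (simp add: B_def pmf.map_comp o_def)
      also have "\<dots> = map_pmf (\<lambda>ys. ys) (?C xs)"
      proof (rule map_pmf_cong[OF refl])
        fix ys assume "ys \<in> set_pmf (?C xs)"
        then have "ys \<in> set_pmf ?Q" "butlast ys = xs"
          using ne[OF xs] by auto
        then show "xs @ [last ys] = ys"
          using len[of ys "rs @ [r]"] by (metis append_butlast_last_id length_0_conv snoc_eq_iff_butlast)
      qed
      finally show "map_pmf (\<lambda>x. xs @ [x]) (B (rs @ [r]) xs) = ?C xs" by simp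
    qed
    \<comment> \<open>Law of total probability: by \<open>consistent\<close>, the fibre of
      \<open>butlast\<close> over \<open>xs\<close> has the same mass under \<open>?Q\<close> as
      \<open>xs\<close> has under \<open>Q rs\<close>, so mixing the conditional laws over
      \<open>Q rs\<close> restores \<open>?Q\<close>.\<close>
    also have "\<dots> = ?Q"
    proof (rule bind_cond_pmf_cancel)
      fix xs ys assume "xs \<in> set_pmf (Q rs)" "ys \<in> set_pmf ?Q" "butlast ys = xs"
      have "measure (measure_pmf (Q rs)) {x. butlast ys = x}
          = measure (measure_pmf (map_pmf butlast ?Q)) {x. butlast ys = x}"
        by (simp only: consistent)
      then show "measure (measure_pmf ?Q) {ys. butlast ys = xs} =
          measure (measure_pmf (Q rs)) {x. butlast ys = x}"
        using \<open>butlast ys = xs\<close> by (auto simp: vimage_def intro!: arg_cong[of _ _ "measure _"])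
    qed (use ne supp in auto)
    finally show ?case .
  qed
  ultimately show thesis by (rule that)
qed

section \<open>A two-state chain with prescribed marginals and few switches\<close>

text \<open>
  The successive marginals \<open>bernoulli_pmf (q rs)\<close> are coupled so that the state changes with the least
  possible probability \<open>\<bar>\<Delta>q\<bar>\<close>.
\<close>

definition switching_chain :: "('r list \<Rightarrow> real) \<Rightarrow> ('r, bool) randomized_algorithm" where
  "switching_chain q rs ss =
     (let p = q (butlast rs); p' = q rs in
      bernoulli_pmf
        (if ss = [] then p'
         else if last ss then min p p' / p
         else 1 - min (1 - p) (1 - p') / (1 - p)))"

text \<open>Maximal coupling: mass \<open>min p p'\<close> stays at True and mass
  \<open>min (1 - p) (1 - p')\<close> stays at False, so the mass entering True is
  \<open>max 0 (p' - p)\<close>, which completes \<open>min p p'\<close> to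
  \<open>p'\<close>.\<close>

lemma bind_bernoulli_coupling:
  assumes "0 < p" "p < 1" "0 < p'" "p' < (1::real)"
  shows "bind_pmf (bernoulli_pmf p)
      (\<lambda>s. bernoulli_pmf (if s then min p p' / p else 1 - min (1 - p) (1 - p') / (1 - p)))
    = bernoulli_pmf p'"
    (is "bind_pmf _ (\<lambda>s. bernoulli_pmf (?k s)) = _")
proof (rule pmf_eqI)
  have k: "?k s \<in> {0..1}" for s using assms by (auto simp: field_simps min_def)
  have t: "?k True * p + ?k False * (1 - p) = p'"
    using assms by (auto simp: field_simps min_def)
  have "pmf (bind_pmf (bernoulli_pmf p) (\<lambda>s. bernoulli_pmf (?k s))) True = p'"
    unfolding pmf_bind using assms k t by (subst integral_bernoulli_pmf) auto
  moreover have "pmf (bind_pmf (bernoulli_pmf p) (\<lambda>s. bernoulli_pmf (?k s))) False = 1 - p'"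
    unfolding pmf_bind using assms k t
    by (subst integral_bernoulli_pmf) (auto simp: algebra_simps)
  ultimately show "pmf (bind_pmf (bernoulli_pmf p) (\<lambda>s. bernoulli_pmf (?k s))) i
      = pmf (bernoulli_pmf p') i" for i
    using assms by (cases i) auto
qed

text \<open>A transition looks only at the last bit, whose law is the previous marginal by
  induction, so the coupling carries it to the next marginal. The request list is nonempty because
  the empty run has no last bit.\<close>

lemma last_run_switching_chain:
  assumes q: "\<And>rs. 0 < q rs \<and> q rs < 1"
  shows "map_pmf last (run (switching_chain q) (rs @ [r])) = bernoulli_pmf (q (rs @ [r]))"
proof (induction rs arbitrary: r rule: rev_induct)
  case Nil
  show ?case
    by (simp add: run_def switching_chain_def bind_return_pmf pmf.map_comp o_def Let_def)
next
  case (snoc r' rs)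
  let ?S = "switching_chain q" let ?rs = "rs @ [r']"
  let ?p = "q ?rs" and ?p' = "q (?rs @ [r])"
  let ?k = "\<lambda>s. if s then min ?p ?p' / ?p else 1 - min (1 - ?p) (1 - ?p') / (1 - ?p)"
  have "map_pmf last (run ?S (?rs @ [r])) = bind_pmf (run ?S ?rs) (\<lambda>ss. ?S (?rs @ [r]) ss)"
    by (subst run_snoc) (simp add: map_bind_pmf pmf.map_comp o_def)
  also have "\<dots> = bind_pmf (run ?S ?rs) (\<lambda>ss. bernoulli_pmf (?k (last ss)))"
  proof (rule bind_pmf_cong[OF refl])
    fix ss assume "ss \<in> set_pmf (run ?S ?rs)"
    then have "ss \<noteq> []" unfolding run_def using set_run_prefix_length by fastforce
    moreover have "butlast (rs @ [r', r]) = ?rs" by (simp add: butlast_append)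
    ultimately show "?S (?rs @ [r]) ss = bernoulli_pmf (?k (last ss))"
      by (simp add: switching_chain_def Let_def)
  qed
  also have "\<dots> = bind_pmf (map_pmf last (run ?S ?rs)) (\<lambda>s. bernoulli_pmf (?k s))"
    by (simp add: bind_map_pmf)
  also have "\<dots> = bernoulli_pmf ?p'"
    unfolding snoc.IH using q by (intro bind_bernoulli_coupling) auto
  finally show ?case .
qed

text \<open>Bit \<open>t\<close> is the last bit of the run on the first \<open>Suc t\<close>
  requests: it is tossed after request \<open>t\<close> has been seen.\<close>

lemma nn_integral_run_switching_chain_nth:
  assumes q: "\<And>rs. 0 < q rs \<and> q rs < 1" and t: "t < length rs"
  shows "(\<integral>\<^sup>+ss. f (ss ! t) \<partial>run (switching_chain q) rs)
    = f True * q (take (Suc t) rs) + f False * (1 - q (take (Suc t) rs))"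
proof -
  let ?S = "switching_chain q"
  have "(\<integral>\<^sup>+ss. f (ss ! t) \<partial>run ?S rs) = (\<integral>\<^sup>+ss. f (last (take (Suc t) ss)) \<partial>run ?S rs)"
    by (rule nn_integral_cong_AE)
      (use t in \<open>auto simp: AE_measure_pmf_iff run_def take_Suc_conv_app_nth dest!: set_run_prefix_length\<close>)
  also have "\<dots> = (\<integral>\<^sup>+s. f s \<partial>map_pmf last (map_pmf (take (Suc t)) (run ?S rs)))"
    by simp
  also have "map_pmf last (map_pmf (take (Suc t)) (run ?S rs)) = bernoulli_pmf (q (take (Suc t) rs))"
    using last_run_switching_chain[of q "take t rs" "rs ! t"] q t
    by (simp add: map_take_run take_Suc_conv_app_nth)
  finally show ?thesis
    using q[of "take (Suc t) rs"] by simp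
qed

text \<open>Under the coupling mass crosses in one direction only: from False to True if the
  marginal grows, from True to False if it shrinks. The crossing mass is the change of the
  marginal.\<close>

lemma nn_integral_run_switching_chain_switch:
  assumes q: "\<And>rs. 0 < q rs \<and> q rs < 1" and t: "Suc t < length rs"
  shows "(\<integral>\<^sup>+ss. (if ss ! t \<noteq> ss ! Suc t then b else 0) \<partial>run (switching_chain q) rs)
    = b * ennreal \<bar>q (take (Suc (Suc t)) rs) - q (take (Suc t) rs)\<bar>"
proof -
  let ?S = "switching_chain q"
  define us where "us = take (Suc t) rs"
  define u where "u = rs ! Suc t"
  have us: "take (Suc (Suc t)) rs = us @ [u]" "length us = Suc t"
    using t by (auto simp: us_def u_def take_Suc_conv_app_nth)
  let ?p = "q us" and ?p' = "q (us @ [u])"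
  let ?k = "\<lambda>s. if s then min ?p ?p' / ?p else 1 - min (1 - ?p) (1 - ?p') / (1 - ?p)"
  have k: "?k s \<in> {0..1}" for s
    using q[of us] q[of "us @ [u]"] by (auto simp: field_simps min_def)
  \<comment> \<open>The expected charge given bit \<open>t\<close>: \<open>?k\<close> is the
    probability that the next bit is True, so True is left with probability
    \<open>1 - ?k True\<close> and False with probability \<open>?k False\<close>.\<close>
  let ?g = "\<lambda>s. if s then b * ennreal (1 - ?k True) else b * ennreal (?k False)"
  have "(\<integral>\<^sup>+ss. (if ss ! t \<noteq> ss ! Suc t then b else 0) \<partial>run ?S rs)
      = (\<integral>\<^sup>+ss. (if ss ! t \<noteq> ss ! Suc t then b else 0) \<partial>map_pmf (take (Suc (Suc t))) (run ?S rs))"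
    by simp
  also have "map_pmf (take (Suc (Suc t))) (run ?S rs) = run ?S (us @ [u])"
    using t us by (simp add: map_take_run)
  also have "(\<integral>\<^sup>+ss. (if ss ! t \<noteq> ss ! Suc t then b else 0) \<partial>run ?S (us @ [u]))
      = (\<integral>\<^sup>+ss. (\<integral>\<^sup>+s. (if (ss @ [s]) ! t \<noteq> (ss @ [s]) ! Suc t then b else 0) \<partial>?S (us @ [u]) ss) \<partial>run ?S us)"
    by (simp add: run_snoc)
  also have "\<dots> = (\<integral>\<^sup>+ss. ?g (ss ! t) \<partial>run ?S us)"
  proof (rule nn_integral_cong_AE, unfold AE_measure_pmf_iff, rule ballI)
    fix ss assume "ss \<in> set_pmf (run ?S us)"
    then have len: "length ss = Suc t" using us by (auto simp: run_def dest: set_run_prefix_length)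
    then have "?S (us @ [u]) ss = bernoulli_pmf (?k (ss ! t))"
      by (auto simp: switching_chain_def Let_def last_conv_nth)
    moreover have "(ss @ [s]) ! t = ss ! t" "(ss @ [s]) ! Suc t = s" for s
      using len by (auto simp: nth_append)
    moreover have "(\<integral>\<^sup>+s. (if a \<noteq> s then b else 0) \<partial>bernoulli_pmf (?k a)) = ?g a" for a
      using k[of a] by (subst nn_integral_bernoulli_pmf) auto
    ultimately show "(\<integral>\<^sup>+s. (if (ss @ [s]) ! t \<noteq> (ss @ [s]) ! Suc t then b else 0) \<partial>?S (us @ [u]) ss)
        = ?g (ss ! t)"
      by (simp only:)
  qed
  also have "\<dots> = ?g True * ennreal ?p + ?g False * ennreal (1 - ?p)"
    using nn_integral_run_switching_chain_nth[of q t us ?g, OF q] us by simp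
  also have "\<dots> = b * (ennreal (1 - ?k True) * ennreal ?p + ennreal (?k False) * ennreal (1 - ?p))"
    by (simp add: distrib_left mult.assoc)
  also have "ennreal (1 - ?k True) * ennreal ?p + ennreal (?k False) * ennreal (1 - ?p)
      = ennreal ((1 - ?k True) * ?p + ?k False * (1 - ?p))"
    using k[of True] k[of False] q[of us]
    by (subst ennreal_plus) (auto simp: ennreal_mult)
  also have "(1 - ?k True) * ?p + ?k False * (1 - ?p) = \<bar>?p' - ?p\<bar>"
    using q[of us] q[of "us @ [u]"] by (auto simp: field_simps min_def abs_if)
  finally show ?thesis using us by (simp add: us_def)
qed

section \<open>Exponential weights and their potential\<close>

text \<open>The Hedge (multiplicative weights) probability of an expert with loss \<open>a\<close>
  against one with loss \<open>b\<close>, at learning rate \<open>\<gamma>\<close>.\<close>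

definition softmin_weight :: "real \<Rightarrow> real \<Rightarrow> real \<Rightarrow> real" where
  "softmin_weight \<gamma> a b = exp (- (\<gamma> * a)) / (exp (- (\<gamma> * a)) + exp (- (\<gamma> * b)))"

lemma softmin_weight_bounds: "0 < softmin_weight \<gamma> a b" "softmin_weight \<gamma> a b < 1"
  by (simp_all add: softmin_weight_def add_pos_pos pos_divide_less_eq)

text \<open>Let the total weight fall from W to V. Since each weight only decreases, a share can
  grow by at most 1 - V/W, which is at most ln (W/V). The two shares sum to 1, so a loss of one is a
  gain of the other and the same bound covers both signs.\<close>

lemma weight_change_le_ln_sum:
  fixes w1 w2 v1 v2 :: real
  assumes "0 < v1" "0 < v2" "v1 \<le> w1" "v2 \<le> w2"
  shows "\<bar>v1 / (v1 + v2) - w1 / (w1 + w2)\<bar> \<le> ln (w1 + w2) - ln (v1 + v2)"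
proof -
  have *: "y / (x + y) - z / (u + z) \<le> ln (u + z) - ln (x + y)"
    if "0 < x" "0 < y" "x \<le> u" "y \<le> z" for x y u z :: real
  proof -
    have pos: "0 < x + y" "0 < u + z" "x + y \<le> u + z" using that by auto
    have "y / (x + y) - z / (u + z) \<le> y / (x + y) - y / (u + z)"
      using that pos by (simp add: divide_right_mono)
    also have "\<dots> = y / (x + y) * (1 - (x + y) / (u + z))"
      using pos by (simp add: field_simps)
    also have "\<dots> \<le> 1 * (1 - (x + y) / (u + z))"
      using that pos by (intro mult_right_mono) auto
    also have "\<dots> \<le> ln (u + z) - ln (x + y)"
      using ln_le_minus_one[of "(x + y) / (u + z)"] pos by (simp add: ln_div)
    finally show ?thesis .
  qed
  have "v1 / (v1 + v2) = 1 - v2 / (v1 + v2)" "w1 / (w1 + w2) = 1 - w2 / (w1 + w2)"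
    using assms by (simp_all add: field_simps)
  with *[of v1 v2 w1 w2] *[of v2 v1 w2 w1] assms show ?thesis
    by (simp add: abs_le_iff add.commute)
qed

text \<open>W/V is the average of \<open>exp (\<gamma> * x)\<close> and
  \<open>exp (\<gamma> * y)\<close> under the weights \<open>p\<close> and \<open>1 - p\<close>, so
  Jensen's inequality for exp gives the claim. These are the weights after the costs
  \<open>x\<close> and \<open>y\<close>; an algorithm that sees the cost function before moving may
  use them, and with them no second-order loss arises.\<close>

lemma softmin_weighted_cost_le_ln_sum:
  fixes a b x y \<gamma> :: real
  defines "p \<equiv> softmin_weight \<gamma> (a + x) (b + y)"
  shows "\<gamma> * (p * x + (1 - p) * y)
    \<le> ln (exp (- (\<gamma> * a)) + exp (- (\<gamma> * b)))
      - ln (exp (- (\<gamma> * (a + x))) + exp (- (\<gamma> * (b + y))))"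
proof -
  let ?W = "exp (- (\<gamma> * a)) + exp (- (\<gamma> * b))"
  let ?V = "exp (- (\<gamma> * (a + x))) + exp (- (\<gamma> * (b + y)))"
  let ?m = "\<gamma> * (p * x + (1 - p) * y)"
  have pos: "0 < ?W" "0 < ?V" by (simp_all add: add_pos_pos)
  have p: "0 \<le> p" "0 \<le> 1 - p"
    using softmin_weight_bounds[of \<gamma> "a + x" "b + y"] by (simp_all add: p_def)
  \<comment> \<open>The tangent of exp at the mean \<open>?m\<close>. Averaged with weights
    \<open>p\<close> and \<open>1 - p\<close> its linear part vanishes, which is Jensen's
    inequality.\<close>
  have tangent: "exp ?m * (1 + (z - ?m)) \<le> exp z" for z
  proof -
    have "exp z = exp ?m * exp (z - ?m)" by (simp add: exp_diff)
    then show ?thesis using exp_ge_add_one_self[of "z - ?m"] by simp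
  qed
  have p_eq: "p = exp (- (\<gamma> * (a + x))) / ?V" "1 - p = exp (- (\<gamma> * (b + y))) / ?V"
    using pos by (auto simp: p_def softmin_weight_def field_simps)
  have "exp ?m = p * (exp ?m * (1 + (\<gamma> * x - ?m))) + (1 - p) * (exp ?m * (1 + (\<gamma> * y - ?m)))"
    by (simp add: algebra_simps)
  also have "\<dots> \<le> p * exp (\<gamma> * x) + (1 - p) * exp (\<gamma> * y)"
    using p tangent by (intro add_mono mult_left_mono)
  also have "\<dots> = (exp (- (\<gamma> * (a + x))) * exp (\<gamma> * x) + exp (- (\<gamma> * (b + y))) * exp (\<gamma> * y)) / ?V"
    unfolding p_eq(2) unfolding p_eq(1) by (simp add: add_divide_distrib)
  also have "\<dots> = ?W / ?V"
    by (simp add: exp_add[symmetric] distrib_left)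
  finally have "?m \<le> ln (?W / ?V)"
    using pos by (subst ln_ge_iff) auto
  then show ?thesis using pos by (simp add: ln_div)
qed

text \<open>Each unit of decrease of the potential \<open>ln (u t + v t)\<close> pays for service
  worth \<open>1 / \<gamma>\<close> and for switching worth \<open>D\<close>. The potential starts
  at ln 2 and cannot end below -\<gamma> times the smaller total. Step \<open>t\<close> is charged
  at \<open>q (Suc t)\<close>, the weight that already includes its costs.\<close>

lemma softmin_combination_cost:
  fixes a b :: "nat \<Rightarrow> real" and D \<epsilon> :: real
  assumes ab: "\<And>t. 0 \<le> a t" "\<And>t. 0 \<le> b t" and "0 < D" "0 < \<epsilon>"
  defines "q \<equiv> \<lambda>t. softmin_weight (\<epsilon> / D) (\<Sum>s<t. a s) (\<Sum>s<t. b s)"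
  shows "(\<Sum>t<T. q (Suc t) * a t + (1 - q (Suc t)) * b t + D * \<bar>q (Suc t) - q t\<bar>)
    \<le> (1 + \<epsilon>) * (min (\<Sum>s<T. a s) (\<Sum>s<T. b s) + D / \<epsilon>)"
proof -
  define \<gamma> where "\<gamma> = \<epsilon> / D"
  have \<gamma>: "0 < \<gamma>" using assms by (simp add: \<gamma>_def)
  define u v where "u t = exp (- (\<gamma> * (\<Sum>s<t. a s)))" and "v t = exp (- (\<gamma> * (\<Sum>s<t. b s)))" for t
  let ?L = "\<lambda>t. ln (u t + v t)"
  have q: "q t = u t / (u t + v t)" for t
    by (simp add: q_def u_def v_def softmin_weight_def \<gamma>_def)
  have step: "q (Suc t) * a t + (1 - q (Suc t)) * b t + D * \<bar>q (Suc t) - q t\<bar>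
      \<le> (1 + \<epsilon>) / \<gamma> * (?L t - ?L (Suc t))" for t
  proof -
    have "\<bar>q (Suc t) - q t\<bar> \<le> ?L t - ?L (Suc t)"
      unfolding q using ab \<gamma> by (intro weight_change_le_ln_sum) (auto simp: u_def v_def)
    then have "D * \<bar>q (Suc t) - q t\<bar> \<le> D * (?L t - ?L (Suc t))"
      using \<open>0 < D\<close> by (intro mult_left_mono) auto
    moreover have "\<gamma> * (q (Suc t) * a t + (1 - q (Suc t)) * b t) \<le> ?L t - ?L (Suc t)"
      using softmin_weighted_cost_le_ln_sum[of \<gamma> "\<Sum>s<t. a s" "a t" "\<Sum>s<t. b s" "b t"]
      by (simp add: q_def u_def v_def \<gamma>_def)
    then have "q (Suc t) * a t + (1 - q (Suc t)) * b t \<le> (?L t - ?L (Suc t)) / \<gamma>"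
      using \<gamma> by (simp add: field_simps)
    ultimately have "q (Suc t) * a t + (1 - q (Suc t)) * b t + D * \<bar>q (Suc t) - q t\<bar>
        \<le> (?L t - ?L (Suc t)) / \<gamma> + D * (?L t - ?L (Suc t))" by simp
    \<comment> \<open>The two charges merge because
      \<open>\<gamma> * D = \<epsilon>\<close>.\<close>
    also have "z / \<gamma> + D * z = (1 + \<epsilon>) / \<gamma> * z" for z
      using assms by (simp add: \<gamma>_def field_simps)
    finally show ?thesis .
  qed
  have "(\<Sum>t<T. q (Suc t) * a t + (1 - q (Suc t)) * b t + D * \<bar>q (Suc t) - q t\<bar>)
      \<le> (\<Sum>t<T. (1 + \<epsilon>) / \<gamma> * (?L t - ?L (Suc t)))"
    by (rule sum_mono) (rule step)
  also have "\<dots> = (1 + \<epsilon>) / \<gamma> * (ln 2 - ?L T)"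
  proof -
    have "(\<Sum>t<T. ?L t - ?L (Suc t)) = ln 2 - ?L T"
      by (subst sum_lessThan_telescope') (simp add: u_def v_def)
    then show ?thesis by (simp only: sum_distrib_left[symmetric])
  qed
  also have "\<dots> \<le> (1 + \<epsilon>) / \<gamma> * (1 + \<gamma> * min (\<Sum>s<T. a s) (\<Sum>s<T. b s))"
  proof (rule mult_left_mono)
    have "0 < u T" "0 < v T" by (simp_all add: u_def v_def)
    then have "ln (u T) \<le> ?L T" "ln (v T) \<le> ?L T" by simp_all
    then have "- (\<gamma> * min (\<Sum>s<T. a s) (\<Sum>s<T. b s)) \<le> ?L T"
      by (simp add: u_def v_def min_def)
    moreover have "ln 2 \<le> (1::real)" using ln_le_minus_one[of "2::real"] by simp
    ultimately show "ln 2 - ?L T \<le> 1 + \<gamma> * min (\<Sum>s<T. a s) (\<Sum>s<T. b s)" by linarith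
  qed (use \<gamma> assms in simp)
  also have "\<dots> = (1 + \<epsilon>) * (min (\<Sum>s<T. a s) (\<Sum>s<T. b s) + D / \<epsilon>)"
  proof -
    have "(1 + \<epsilon>) / \<gamma> * (1 + \<gamma> * m) = (1 + \<epsilon>) * (m + 1 / \<gamma>)" for m
      using \<gamma> by (simp add: field_simps)
    then show ?thesis by (simp add: \<gamma>_def)
  qed
  finally show ?thesis .
qed

section \<open>Following the predictions greedily\<close>

definition near_prediction ::
  "'a set \<Rightarrow> ('a \<Rightarrow> 'a \<Rightarrow> real) \<Rightarrow> real \<Rightarrow> ('a \<Rightarrow> ennreal) \<Rightarrow> 'a \<Rightarrow> 'a" where
  "near_prediction M d \<delta> l p = (SOME x. x \<in> M \<and>
     (\<forall>y\<in>M. l x + ennreal (2 * d x p) \<le> l y + ennreal (2 * d y p) + ennreal \<delta>))"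

lemma near_prediction:
  assumes "M \<noteq> {}" "0 < \<delta>"
  shows "near_prediction M d \<delta> l p \<in> M"
    and "y \<in> M \<Longrightarrow> l (near_prediction M d \<delta> l p) + ennreal (2 * d (near_prediction M d \<delta> l p) p)
      \<le> l y + ennreal (2 * d y p) + ennreal \<delta>"
proof -
  define g where "g x = l x + ennreal (2 * d x p)" for x
  let ?x = "near_prediction M d \<delta> l p"
  obtain x0 where "x0 \<in> M" using assms by blast
  have "\<exists>x. x \<in> M \<and> (\<forall>y\<in>M. g x \<le> g y + ennreal \<delta>)"
  \<comment> \<open>With an infinite infimum no state lies strictly below the infimum plus \<delta>,
    but then all states tie at infinity and any of them serves.\<close>
  proof (cases "(INF x\<in>M. g x) = \<infinity>")
    case True
    have "g y = \<infinity>" if "y \<in> M" for y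
      using INF_lower[OF that, of g] True by (simp add: top_unique)
    with \<open>x0 \<in> M\<close> show ?thesis by (intro exI[of _ x0]) simp
  next
    case False
    then have "(INF x\<in>M. g x) + 0 < (INF x\<in>M. g x) + ennreal \<delta>"
      using assms by (subst ennreal_add_left_cancel_less) simp
    then obtain x where x: "x \<in> M" "g x < (INF x\<in>M. g x) + ennreal \<delta>"
      by (auto simp: INF_less_iff)
    have "g x \<le> g y + ennreal \<delta>" if "y \<in> M" for y
      using less_imp_le[OF x(2)] add_right_mono[OF INF_lower[OF that, of g]] by (rule order.trans)
    then show ?thesis using x(1) by blast
  qed
  then have *: "?x \<in> M \<and> (\<forall>y\<in>M. g ?x \<le> g y + ennreal \<delta>)"
    unfolding near_prediction_def g_def by (rule someI_ex)
  then show "?x \<in> M" by (rule conjunct1)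
  show "l ?x + ennreal (2 * d ?x p) \<le> l y + ennreal (2 * d y p) + ennreal \<delta>" if "y \<in> M"
    using conjunct2[OF *] that unfolding g_def by (rule bspec)
qed

definition step_cost ::
  "('a \<Rightarrow> 'a \<Rightarrow> real) \<Rightarrow> 'a \<Rightarrow> ('a \<Rightarrow> ennreal) list \<Rightarrow> 'a list \<Rightarrow> nat \<Rightarrow> ennreal" where
  "step_cost d x0 ls xs t = ennreal (d ((x0 # xs) ! t) (xs ! t)) + (ls ! t) (xs ! t)"

lemma mts_cost_take:
  "t \<le> length ls \<Longrightarrow> mts_cost d x0 (take t ls) (take t xs) = (\<Sum>s<t. step_cost d x0 ls xs s)"
  unfolding mts_cost_def step_cost_def
  by (intro sum.cong) (auto simp: nth_Cons split: nat.split)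

lemma mts_cost_eq_sum_step_cost:
  "mts_cost d x0 ls xs = (\<Sum>t<length ls. step_cost d x0 ls xs t)"
  by (simp add: mts_cost_def step_cost_def)

text \<open>The expected cost so far, which an online algorithm can compute from the requests
  received, is a partial sum of the expected step costs on the full input. This makes the weights of
  the mixture telescope.\<close>

lemma expected_cost_take:
  assumes "t \<le> length ls"
  shows "expected_cost d x0 (take t ls) (run A (take t ls))
    = (\<Sum>s<t. \<integral>\<^sup>+xs. step_cost d x0 ls xs s \<partial>run A ls)"
proof -
  have "expected_cost d x0 (take t ls) (run A (take t ls))
      = (\<integral>\<^sup>+xs. (\<Sum>s<t. step_cost d x0 ls xs s) \<partial>run A ls)"
    unfolding map_take_run[OF assms, symmetric] expected_cost_def
    by (simp add: mts_cost_take assms)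
  then show ?thesis by (simp add: nn_integral_sum)
qed

text \<open>Lists start at index 0, hence the slack \<open>D / 2 ^ Suc t\<close>; the slacks sum to
  less than \<open>D\<close>. Each state depends on its own request only, so the sequence is
  deterministic and truncates with the input.\<close>

definition follow_prediction ::
  "'a set \<Rightarrow> ('a \<Rightarrow> 'a \<Rightarrow> real) \<Rightarrow> real \<Rightarrow> (('a \<Rightarrow> ennreal) \<times> 'a) list \<Rightarrow> 'a list" where
  "follow_prediction M d D rs =
     map (\<lambda>t. near_prediction M d (D / 2 ^ Suc t) (fst (rs ! t)) (snd (rs ! t))) [0..<length rs]"

lemma length_follow_prediction [simp]: "length (follow_prediction M d D rs) = length rs"
  by (simp add: follow_prediction_def)

lemma take_follow_prediction:
  "take t (follow_prediction M d D rs) = follow_prediction M d D (take t rs)"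
  by (rule nth_equalityI) (auto simp: follow_prediction_def)

lemma set_follow_prediction:
  assumes "M \<noteq> {}" "0 < D"
  shows "set (follow_prediction M d D rs) \<subseteq> M"
  using assms near_prediction(1)[of M] by (auto simp: follow_prediction_def)

text \<open>The potential \<open>gap\<close> starts at 0, as both sequences start in
  \<open>x0\<close>, and is nonnegative at the end. Of the 4 d(p, o) charged per step, one half
  comes from rerouting through the prediction and the other from comparing the greedy choice with
  the offline state.\<close>

lemma (in metrical_task_system) follow_prediction_cost:
  assumes "0 < D" "length ps = length ls" "length os = length ls" "set ps \<subseteq> M" "set os \<subseteq> M"
  shows "mts_cost d x0 ls (follow_prediction M d D (zip ls ps))
    \<le> mts_cost d x0 ls os + ennreal (4 * prediction_error d ps os) + ennreal D"
proof -
  define fs where "fs = follow_prediction M d D (zip ls ps)"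
  let ?T = "length ls"
  let ?c = "\<lambda>xs. step_cost d x0 ls xs"
  define gap where "gap t = d ((x0 # fs) ! t) ((x0 # os) ! t)" for t
  define slack where "slack t = 4 * d (ps ! t) (os ! t) + D / 2 ^ Suc t" for t
  have slack: "0 \<le> slack t" for t using \<open>0 < D\<close> by (simp add: slack_def)
  have len: "length fs = ?T" using assms by (simp add: fs_def)
  have fsM: "set fs \<subseteq> M"
    unfolding fs_def using initial_state \<open>0 < D\<close> by (intro set_follow_prediction) auto
  \<comment> \<open>The new potential is added on the left rather than subtracted on the right,
    because subtraction in \<open>ennreal\<close> is truncated.\<close>
  have step: "?c fs t + ennreal (gap (Suc t)) \<le> ennreal (gap t) + ?c os t + ennreal (slack t)"
    if t: "t < ?T" for t
  proof -
    let ?f = "(x0 # fs) ! t" and ?o = "(x0 # os) ! t" and ?l = "ls ! t" and ?p = "ps ! t"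
    let ?f' = "fs ! t" and ?o' = "os ! t"
    have mem: "?f' \<in> M" "?o' \<in> M" "?p \<in> M"
      using t len assms fsM by (auto dest: nth_mem)
    have mem0: "?f \<in> M" "?o \<in> M"
      using t len assms fsM initial_state by (auto simp: nth_Cons subset_iff split: nat.split)
    have "?f' = near_prediction M d (D / 2 ^ Suc t) ?l ?p"
      using t assms by (simp add: fs_def follow_prediction_def)
    then have greedy: "?l ?f' + ennreal (2 * d ?f' ?p)
        \<le> ?l ?o' + ennreal (2 * d ?o' ?p) + ennreal (D / 2 ^ Suc t)"
      using near_prediction(2)[where M = M and d = d and y = ?o' and l = ?l and p = ?p and \<delta> = "D / 2 ^ Suc t"] mem \<open>0 < D\<close> by auto
    \<comment> \<open>The distance from the new state to \<open>?o'\<close> is paid twice, once in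
      the move and once in the new potential. Routing it through the prediction leaves
      \<open>2 * d ?f' ?p\<close>, the very term in the greedy objective; this is where its factor 2
      comes from.\<close>
    have "d ?f ?f' + d ?f' ?o' \<le> d ?f ?o + d ?o ?o' + 2 * d ?o' ?f'"
      using triangle[of ?f ?o ?f'] triangle[of ?o ?o' ?f'] mem mem0 commute[of ?f' ?o'] by linarith
    also have "\<dots> \<le> d ?f ?o + d ?o ?o' + 2 * d ?p ?o' + 2 * d ?f' ?p"
      using triangle[of ?f' ?p ?o'] mem commute[of ?f' ?o'] by linarith
    finally have move: "ennreal (d ?f ?f' + d ?f' ?o')
        \<le> ennreal (d ?f ?o + d ?o ?o' + 2 * d ?p ?o' + 2 * d ?f' ?p)"
      by (rule ennreal_leI)
    have "?c fs t + ennreal (gap (Suc t)) = ennreal (d ?f ?f' + d ?f' ?o') + ?l ?f'"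
      by (simp add: step_cost_def gap_def ac_simps)
    also have "\<dots> \<le> ennreal (d ?f ?o + d ?o ?o' + 2 * d ?p ?o' + 2 * d ?f' ?p) + ?l ?f'"
      by (rule add_right_mono[OF move])
    also have "\<dots> = ennreal (d ?f ?o + d ?o ?o' + 2 * d ?p ?o') + (?l ?f' + ennreal (2 * d ?f' ?p))"
      by (simp add: ac_simps)
    also have "\<dots> \<le> ennreal (d ?f ?o + d ?o ?o' + 2 * d ?p ?o')
        + (?l ?o' + ennreal (2 * d ?o' ?p) + ennreal (D / 2 ^ Suc t))"
      by (rule add_left_mono[OF greedy])
    also have "\<dots> = ennreal (d ?f ?o + d ?o ?o' + 2 * d ?p ?o' + 2 * d ?o' ?p + D / 2 ^ Suc t) + ?l ?o'"
      using \<open>0 < D\<close> by (simp add: ac_simps del: power_Suc)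
    also have "d ?f ?o + d ?o ?o' + 2 * d ?p ?o' + 2 * d ?o' ?p + D / 2 ^ Suc t
        = d ?f ?o + d ?o ?o' + slack t"
      by (simp add: slack_def commute[of ?o' ?p])
    also have "ennreal (d ?f ?o + d ?o ?o' + slack t) + ?l ?o' = ennreal (gap t) + ?c os t + ennreal (slack t)"
      using slack by (simp add: step_cost_def gap_def ac_simps)
    finally show ?thesis .
  qed
  have "(\<Sum>t<n. ?c fs t) + ennreal (gap n) \<le> (\<Sum>t<n. ?c os t) + ennreal (\<Sum>t<n. slack t)" if "n \<le> ?T" for n
    using that
  proof (induction n)
    case 0
    then show ?case using initial_state by (simp add: gap_def)
  next
    case (Suc n)
    have "(\<Sum>t<Suc n. ?c fs t) + ennreal (gap (Suc n)) = (\<Sum>t<n. ?c fs t) + (?c fs n + ennreal (gap (Suc n)))"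
      by (simp add: ac_simps)
    also have "\<dots> \<le> (\<Sum>t<n. ?c fs t) + (ennreal (gap n) + ?c os n + ennreal (slack n))"
      using step[of n] Suc.prems by (intro add_left_mono) simp
    also have "\<dots> = ((\<Sum>t<n. ?c fs t) + ennreal (gap n)) + (?c os n + ennreal (slack n))"
      by (simp add: ac_simps)
    also have "\<dots> \<le> ((\<Sum>t<n. ?c os t) + ennreal (\<Sum>t<n. slack t)) + (?c os n + ennreal (slack n))"
      using Suc by (intro add_right_mono) simp
    also have "\<dots> = (\<Sum>t<Suc n. ?c os t) + ennreal (\<Sum>t<Suc n. slack t)"
      using slack by (simp add: sum_nonneg ac_simps)
    finally show ?case .
  qed
  from this[of ?T] have "mts_cost d x0 ls fs \<le> mts_cost d x0 ls os + ennreal (\<Sum>t<?T. slack t)"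
    unfolding mts_cost_eq_sum_step_cost using le_add_same_cancel1 order.trans
    by (metis le_iff_add order_refl)
  also have "(\<Sum>t<?T. slack t) = 4 * prediction_error d ps os + (\<Sum>t<?T. D / 2 ^ Suc t)"
    using assms by (simp add: slack_def sum.distrib sum_distrib_left prediction_error_def)
  also have "(\<Sum>t<?T. D / 2 ^ Suc t) = D * (1 - 1 / 2 ^ ?T)"
  proof -
    have "(\<Sum>t<n. D / 2 ^ Suc t) = D * (1 - 1 / 2 ^ n)" for n
      by (induction n) (simp_all add: field_simps)
    then show ?thesis .
  qed
  also have "ennreal (4 * prediction_error d ps os + D * (1 - 1 / 2 ^ ?T))
      \<le> ennreal (4 * prediction_error d ps os + D)"
    using \<open>0 < D\<close> by (intro ennreal_leI add_left_mono) (simp add: mult_le_cancel_left1)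
  also have "\<dots> = ennreal (4 * prediction_error d ps os) + ennreal D"
    using \<open>0 < D\<close> by (simp add: prediction_error_def sum_nonneg)
  finally show ?thesis by (simp add: fs_def add.assoc add_left_mono)
qed

section \<open>Cost of switching between two state sequences\<close>

definition mix :: "bool list \<Rightarrow> 'a list \<Rightarrow> 'a list \<Rightarrow> 'a list" where
  "mix ss xs ys = map (\<lambda>t. if ss ! t then xs ! t else ys ! t) [0..<length ss]"

lemma length_mix [simp]: "length (mix ss xs ys) = length ss"
  by (simp add: mix_def)

lemma nth_mix [simp]: "t < length ss \<Longrightarrow> mix ss xs ys ! t = (if ss ! t then xs ! t else ys ! t)"
  by (simp add: mix_def)

lemma set_mix:
  "length xs = length ss \<Longrightarrow> length ys = length ss \<Longrightarrow> set (mix ss xs ys) \<subseteq> set xs \<union> set ys"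
  by (auto simp: mix_def)

lemma butlast_mix:
  "length xs = length ss \<Longrightarrow> length ys = length ss \<Longrightarrow>
    butlast (mix ss xs ys) = mix (butlast ss) (butlast xs) (butlast ys)"
  by (rule nth_equalityI) (auto simp: nth_butlast)

text \<open>Without a switch the mixture moves exactly as the sequence it follows; after a switch
  its move is at most the diameter bound \<open>D\<close>. At time 0 there is nothing to charge,
  since both sequences leave from \<open>x0\<close>.\<close>

lemma step_cost_mix:
  assumes bound: "\<And>x y. x \<in> M \<Longrightarrow> y \<in> M \<Longrightarrow> d x y \<le> D"
    and "set xs \<subseteq> M" "set ys \<subseteq> M" "length xs = length ss" "length ys = length ss" "t < length ss"
  shows "step_cost d x0 ls (mix ss xs ys) t
    \<le> (if ss ! t then step_cost d x0 ls xs t else step_cost d x0 ls ys t)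
      + (case t of 0 \<Rightarrow> 0 | Suc s \<Rightarrow> if ss ! s \<noteq> ss ! Suc s then ennreal D else 0)"
proof (cases t)
  case 0
  then show ?thesis using assms by (auto simp: step_cost_def)
next
  case (Suc s)
  have "ennreal (d x y) + l \<le> ennreal (d z y) + l + ennreal D" if "x \<in> M" "y \<in> M" for x y z l
  proof -
    have "ennreal (d x y) + l \<le> ennreal D + l"
      using bound[OF that] by (intro add_right_mono ennreal_leI)
    also have "\<dots> \<le> ennreal (d z y) + l + ennreal D" by (simp add: ac_simps)
    finally show ?thesis .
  qed
  moreover have "xs ! s \<in> M" "ys ! s \<in> M" "xs ! t \<in> M" "ys ! t \<in> M"
    using assms Suc by (auto dest: nth_mem)
  ultimately show ?thesis
    using assms(6) Suc by (auto simp: step_cost_def)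
qed

text \<open>The bits depend on the requests only and are drawn independently of \<open>X\<close>.
  Hence the chance of following \<open>X\<close> at step \<open>t\<close> multiplies the full
  expected step cost of \<open>X\<close>.\<close>

lemma expected_cost_mix:
  fixes X :: "'a list pmf" and q :: "'r list \<Rightarrow> real"
  assumes bound: "\<And>x y. x \<in> M \<Longrightarrow> y \<in> M \<Longrightarrow> d x y \<le> D"
    and X: "\<And>xs. xs \<in> set_pmf X \<Longrightarrow> set xs \<subseteq> M \<and> length xs = length ls"
    and ys: "set ys \<subseteq> M" "length ys = length ls" and rs: "length rs = length ls"
    and q: "\<And>rs. 0 < q rs \<and> q rs < 1"
  shows "expected_cost d x0 ls
      (map_pmf (\<lambda>(xs, ss). mix ss xs ys) (pair_pmf X (run (switching_chain q) rs)))
    \<le> (\<Sum>t<length ls. (\<integral>\<^sup>+xs. step_cost d x0 ls xs t \<partial>X) * ennreal (q (take (Suc t) rs))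
        + step_cost d x0 ls ys t * ennreal (1 - q (take (Suc t) rs))
        + ennreal D * ennreal \<bar>q (take (Suc t) rs) - q (take t rs)\<bar>)"
proof -
  let ?S = "run (switching_chain q) rs"
  let ?c = "step_cost d x0 ls"
  let ?sw = "\<lambda>ss t. case t of 0 \<Rightarrow> 0 | Suc s \<Rightarrow> if ss ! s \<noteq> ss ! Suc s then ennreal D else 0"
  have S: "length ss = length ls" if "ss \<in> set_pmf ?S" for ss
    using that rs by (auto simp: run_def dest: set_run_prefix_length)
  have "expected_cost d x0 ls (map_pmf (\<lambda>(xs, ss). mix ss xs ys) (pair_pmf X ?S))
      = (\<integral>\<^sup>+(xs, ss). (\<Sum>t<length ls. ?c (mix ss xs ys) t) \<partial>pair_pmf X ?S)"
    by (simp add: expected_cost_def mts_cost_eq_sum_step_cost case_prod_unfold)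
  also have "\<dots> \<le> (\<integral>\<^sup>+(xs, ss). (\<Sum>t<length ls. (if ss ! t then ?c xs t else ?c ys t) + ?sw ss t) \<partial>pair_pmf X ?S)"
  proof (rule nn_integral_mono_AE, unfold AE_measure_pmf_iff, rule ballI)
    fix z assume "z \<in> set_pmf (pair_pmf X ?S)"
    then obtain xs ss where z: "z = (xs, ss)" "xs \<in> set_pmf X" "ss \<in> set_pmf ?S" by auto
    have "?c (mix ss xs ys) t \<le> (if ss ! t then ?c xs t else ?c ys t) + ?sw ss t"
      if "t < length ls" for t
      using that X[OF z(2)] S[OF z(3)] ys by (intro step_cost_mix[of M] bound) auto
    then show "(case z of (xs, ss) \<Rightarrow> \<Sum>t<length ls. ?c (mix ss xs ys) t)
        \<le> (case z of (xs, ss) \<Rightarrow> \<Sum>t<length ls. (if ss ! t then ?c xs t else ?c ys t) + ?sw ss t)"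
      unfolding z(1) prod.case by (intro sum_mono) simp
  qed
  \<comment> \<open>Swapping the factors of the product puts the bits in the outer integral; once
    they are fixed, only the states of \<open>X\<close> remain to be averaged.\<close>
  also have "\<dots> = (\<Sum>t<length ls. (\<integral>\<^sup>+ss. (\<integral>\<^sup>+xs. (if ss ! t then ?c xs t else ?c ys t) \<partial>X) \<partial>?S)
      + (\<integral>\<^sup>+ss. ?sw ss t \<partial>?S))"
    by (subst pair_commute_pmf)
      (simp add: case_prod_unfold nn_integral_sum nn_integral_pair_pmf' nn_integral_add
        cong: if_cong nat.case_cong)
  also have "\<dots> \<le> (\<Sum>t<length ls. (\<integral>\<^sup>+xs. ?c xs t \<partial>X) * ennreal (q (take (Suc t) rs))
      + ?c ys t * ennreal (1 - q (take (Suc t) rs))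
      + ennreal D * ennreal \<bar>q (take (Suc t) rs) - q (take t rs)\<bar>)"
  proof (intro sum_mono add_mono)
    fix t assume t: "t \<in> {..<length ls}"
    have "(\<integral>\<^sup>+ss. (\<integral>\<^sup>+xs. (if ss ! t then ?c xs t else ?c ys t) \<partial>X) \<partial>?S)
        = (\<integral>\<^sup>+ss. (if ss ! t then (\<integral>\<^sup>+xs. ?c xs t \<partial>X) else ?c ys t) \<partial>?S)"
      by (rule nn_integral_cong) auto
    also have "\<dots> = (\<integral>\<^sup>+xs. ?c xs t \<partial>X) * ennreal (q (take (Suc t) rs))
        + ?c ys t * ennreal (1 - q (take (Suc t) rs))"
      using t rs by (subst nn_integral_run_switching_chain_nth[OF q]) auto
    finally show "(\<integral>\<^sup>+ss. (\<integral>\<^sup>+xs. (if ss ! t then ?c xs t else ?c ys t) \<partial>X) \<partial>?S)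
      \<le> (\<integral>\<^sup>+xs. ?c xs t \<partial>X) * ennreal (q (take (Suc t) rs))
        + ?c ys t * ennreal (1 - q (take (Suc t) rs))" by simp
    show "(\<integral>\<^sup>+ss. ?sw ss t \<partial>?S) \<le> ennreal D * ennreal \<bar>q (take (Suc t) rs) - q (take t rs)\<bar>"
      using t rs nn_integral_run_switching_chain_switch[where q = q and t = "t - 1" and rs = rs and b = "ennreal D", OF q] by (cases t) auto
  qed
  finally show ?thesis .
qed

section \<open>The combined algorithm\<close>

text \<open>The weights use the expected cost of \<open>A\<close>, not its sampled cost, so that
  they are functions of the requests and the bits can be independent of the run of \<open>A\<close>.
  The two costs are assumed finite on the input because the weights are computed from real
  numbers.\<close>

lemma (in metrical_task_system) robust_combination:
  fixes A :: "('a \<Rightarrow> ennreal, 'a) randomized_algorithm"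
  assumes A: "online_algorithm M A" and bound: "\<And>x y. x \<in> M \<Longrightarrow> y \<in> M \<Longrightarrow> d x y \<le> D"
    and "0 < D" "0 < \<epsilon>"
  obtains B :: "(('a \<Rightarrow> ennreal) \<times> 'a, 'a) randomized_algorithm"
  where "online_algorithm M B"
    and "\<And>ls ps. length ps = length ls \<Longrightarrow> expected_cost d x0 ls (run A ls) < \<infinity> \<Longrightarrow>
      mts_cost d x0 ls (follow_prediction M d D (zip ls ps)) < \<infinity> \<Longrightarrow>
      expected_cost d x0 ls (run B (zip ls ps))
        \<le> ennreal (1 + \<epsilon>) *
          (min (expected_cost d x0 ls (run A ls)) (mts_cost d x0 ls (follow_prediction M d D (zip ls ps)))
            + ennreal (D / \<epsilon>))"
proof -
  let ?F = "follow_prediction M d D"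
  \<comment> \<open>\<open>enn2real\<close> sends infinity to 0. On inputs with finite total costs
    all prefix costs are finite as well, and there the weights are the intended ones.\<close>
  define q where "q rs = softmin_weight (\<epsilon> / D)
    (enn2real (expected_cost d x0 (map fst rs) (run A (map fst rs))))
    (enn2real (mts_cost d x0 (map fst rs) (?F rs)))" for rs
  have q: "0 < q rs \<and> q rs < 1" for rs by (simp add: q_def softmin_weight_bounds)
  let ?S = "run (switching_chain q)"
  \<comment> \<open>The run of \<open>A\<close> and the bits cannot be read off from the visible
    states. So only the law of the visible sequence is defined here, and an algorithm recalling just
    its own states is then obtained from the consistency of these laws.\<close>
  define Q where "Q rs = map_pmf (\<lambda>(xs, ss). mix ss xs (?F rs)) (pair_pmf (run A (map fst rs)) (?S rs))" for rs
  have F: "set (?F rs) \<subseteq> M" for rs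
    using initial_state \<open>0 < D\<close> by (intro set_follow_prediction) auto
  have runA: "set xs \<subseteq> M" "length xs = length ls" if "xs \<in> set_pmf (run A ls)" for xs ls
    using that set_run_prefix_subset[OF A] set_run_prefix_length unfolding run_def by blast+
  have S: "length ss = length rs" if "ss \<in> set_pmf (?S rs)" for ss rs
    using that set_run_prefix_length unfolding run_def by blast
  obtain B where B: "online_algorithm M B" "\<And>rs. run B rs = Q rs"
  proof (rule online_algorithm_of_consistent_laws[of Q M x0])
    show "length xs = length rs" if "xs \<in> set_pmf (Q rs)" for xs rs
      using that S by (auto simp: Q_def)
    show "set xs \<subseteq> M" if "xs \<in> set_pmf (Q rs)" for xs rs
    proof -
      from that obtain ys ss where "xs = mix ss ys (?F rs)" "ys \<in> set_pmf (run A (map fst rs))"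
        "ss \<in> set_pmf (?S rs)" by (auto simp: Q_def)
      then show ?thesis
        using set_mix[of ys ss "?F rs"] runA[of ys "map fst rs"] S[of ss rs] F[of rs] by auto
    qed
    show "map_pmf butlast (Q (rs @ [r])) = Q rs" for rs r
    proof -
      let ?rs = "rs @ [r]"
      have FP: "butlast (?F ?rs) = ?F rs"
        by (simp add: butlast_conv_take take_follow_prediction)
      \<comment> \<open>Truncation passes through \<open>mix\<close> to the run of \<open>A\<close>,
        the bits and the greedy sequence, each of which is consistent under truncation.\<close>
      have "map_pmf butlast (Q ?rs)
          = map_pmf (\<lambda>(xs, ss). butlast (mix ss xs (?F ?rs))) (pair_pmf (run A (map fst ?rs)) (?S ?rs))"
        by (simp add: Q_def pmf.map_comp o_def case_prod_unfold)
      also have "\<dots> = map_pmf (\<lambda>(xs, ss). mix (butlast ss) (butlast xs) (?F rs))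
          (pair_pmf (run A (map fst ?rs)) (?S ?rs))"
      proof (rule map_pmf_cong[OF refl])
        fix z assume "z \<in> set_pmf (pair_pmf (run A (map fst ?rs)) (?S ?rs))"
        then obtain xs ss where z: "z = (xs, ss)" "xs \<in> set_pmf (run A (map fst ?rs))" "ss \<in> set_pmf (?S ?rs)"
          by auto
        then have "length xs = length ss" "length (?F ?rs) = length ss"
          using runA(2)[OF z(2)] S[OF z(3)] by simp_all
        from butlast_mix[OF this]
        show "(case z of (xs, ss) \<Rightarrow> butlast (mix ss xs (?F ?rs)))
            = (case z of (xs, ss) \<Rightarrow> mix (butlast ss) (butlast xs) (?F rs))"
          by (simp add: z FP)
      qed
      also have "\<dots> = map_pmf (\<lambda>(xs, ss). mix ss xs (?F rs))
          (map_pmf (\<lambda>(xs, ss). (butlast xs, butlast ss)) (pair_pmf (run A (map fst ?rs)) (?S ?rs)))"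
        by (simp add: pmf.map_comp o_def case_prod_unfold)
      also have "\<dots> = Q rs"
        by (simp add: map_pair map_butlast_run Q_def)
      finally show ?thesis .
    qed
  qed (use initial_state in auto)
  show thesis
  proof (rule that[OF B(1)])
    fix ls :: "('a \<Rightarrow> ennreal) list" and ps :: "'a list"
    assume len: "length ps = length ls"
    define rs where "rs = zip ls ps"
    let ?EA = "expected_cost d x0 ls (run A ls)" and ?EF = "mts_cost d x0 ls (?F (zip ls ps))"
    assume fin: "?EA < \<infinity>" "?EF < \<infinity>"
    let ?T = "length ls"
    define a where "a t = (\<integral>\<^sup>+xs. step_cost d x0 ls xs t \<partial>run A ls)" for t
    define b where "b t = step_cost d x0 ls (?F rs) t" for t
    have rs: "length rs = ?T" "map fst rs = ls" using len by (simp_all add: rs_def)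
    have EA: "expected_cost d x0 (take t ls) (run A (take t ls)) = (\<Sum>s<t. a s)" if "t \<le> ?T" for t
      using that by (simp add: expected_cost_take a_def)
    have EF: "mts_cost d x0 (take t ls) (?F (take t rs)) = (\<Sum>s<t. b s)" if "t \<le> ?T" for t
      using mts_cost_take[OF that, of d x0 "?F rs"] by (simp add: take_follow_prediction b_def)
    have "a t < top" "b t < top" if "t < ?T" for t
      using EA[of ?T] EF[of ?T] fin that rs by (auto simp: rs_def)
    then have ab: "a t = ennreal (enn2real (a t))" "b t = ennreal (enn2real (b t))" if "t < ?T" for t
      using that by simp_all
    \<comment> \<open>The weights as a function of time along this input, in the form of
      \<open>softmin_combination_cost\<close>; by \<open>EA\<close> and \<open>EF\<close> they agree
      with \<open>q\<close> on all prefixes.\<close>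
    define q' where "q' t = softmin_weight (\<epsilon> / D) (\<Sum>s<t. enn2real (a s)) (\<Sum>s<t. enn2real (b s))" for t
    have ab_sum: "(\<Sum>s<t. a s) = ennreal (\<Sum>s<t. enn2real (a s))"
      "(\<Sum>s<t. b s) = ennreal (\<Sum>s<t. enn2real (b s))" if "t \<le> ?T" for t
      using that ab by (simp_all add: sum_ennreal[symmetric])
    have q': "q (take t rs) = q' t" if "t \<le> ?T" for t
      using EA[OF that] EF[OF that]
      by (simp add: q_def q'_def take_map[symmetric] rs(2) ab_sum[OF that] sum_nonneg)
    have q'_bounds: "0 \<le> q' t" "0 \<le> 1 - q' t" for t
      using softmin_weight_bounds[of "\<epsilon> / D"] by (simp_all add: q'_def less_imp_le)
    have "expected_cost d x0 ls (run B rs)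
        \<le> (\<Sum>t<?T. a t * ennreal (q (take (Suc t) rs)) + b t * ennreal (1 - q (take (Suc t) rs))
          + ennreal D * ennreal \<bar>q (take (Suc t) rs) - q (take t rs)\<bar>)"
      unfolding B(2) Q_def a_def b_def rs(2)
      by (rule expected_cost_mix[where M = M]) (use bound runA F q rs in auto)
    also have "\<dots> = (\<Sum>t<?T. ennreal (q' (Suc t) * enn2real (a t) + (1 - q' (Suc t)) * enn2real (b t)
        + D * \<bar>q' (Suc t) - q' t\<bar>))"
    proof (rule sum.cong[OF refl])
      fix t assume "t \<in> {..<?T}"
      then have t: "t < ?T" by simp
      have "a t * ennreal (q' (Suc t)) + b t * ennreal (1 - q' (Suc t)) + ennreal D * ennreal \<bar>q' (Suc t) - q' t\<bar>
        = ennreal (q' (Suc t) * enn2real (a t) + (1 - q' (Suc t)) * enn2real (b t) + D * \<bar>q' (Suc t) - q' t\<bar>)"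
        apply (subst (1) ab(1)[OF t])
        apply (subst (1) ab(2)[OF t])
        using q'_bounds[of "Suc t"] \<open>0 < D\<close>
        by (simp add: ennreal_mult[symmetric] ennreal_plus[symmetric] mult.commute del: ennreal_plus)
      then show "a t * ennreal (q (take (Suc t) rs)) + b t * ennreal (1 - q (take (Suc t) rs))
          + ennreal D * ennreal \<bar>q (take (Suc t) rs) - q (take t rs)\<bar>
        = ennreal (q' (Suc t) * enn2real (a t) + (1 - q' (Suc t)) * enn2real (b t) + D * \<bar>q' (Suc t) - q' t\<bar>)"
        using t by (simp add: q')
    qed
    also have "\<dots> = ennreal (\<Sum>t<?T. q' (Suc t) * enn2real (a t) + (1 - q' (Suc t)) * enn2real (b t)
        + D * \<bar>q' (Suc t) - q' t\<bar>)"
      using q'_bounds \<open>0 < D\<close> by (intro sum_ennreal) simp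
    also have "\<dots> \<le> ennreal ((1 + \<epsilon>) *
        (min (\<Sum>t<?T. enn2real (a t)) (\<Sum>t<?T. enn2real (b t)) + D / \<epsilon>))"
      unfolding q'_def using assms by (intro ennreal_leI softmin_combination_cost) auto
    also have "\<dots> = ennreal (1 + \<epsilon>) *
        (min (ennreal (\<Sum>t<?T. enn2real (a t))) (ennreal (\<Sum>t<?T. enn2real (b t))) + ennreal (D / \<epsilon>))"
      using assms by (simp add: ennreal_mult sum_nonneg min_def)
    also have "ennreal (\<Sum>t<?T. enn2real (a t)) = ?EA"
      using EA[of ?T] ab_sum(1)[of ?T] by simp
    also have "ennreal (\<Sum>t<?T. enn2real (b t)) = ?EF"
      using EF[of ?T] ab_sum(2)[of ?T] rs by (simp add: rs_def)
    finally show "expected_cost d x0 ls (run B (zip ls ps)) \<le> ennreal (1 + \<epsilon>) * (min ?EA ?EF + ennreal (D / \<epsilon>))"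
      by (simp only: rs_def)
  qed
qed

section \<open>Passing to the bound with ratio and error, and degenerate cases\<close>

text \<open>On a single request of constant cost K every algorithm pays at least K, while staying
  put costs exactly K. A ratio below 1 fails once K outgrows the additive constant.\<close>

lemma (in metrical_task_system) competitive_ratio_ge_1:
  assumes A: "online_algorithm M A" and comp: "competitive_with_constant M d x0 A \<alpha> c" and "0 \<le> c"
  shows "1 \<le> \<alpha>"
proof (rule ccontr)
  assume "\<not> 1 \<le> \<alpha>"
  \<comment> \<open>\<open>ennreal\<close> maps a negative ratio to 0, so \<beta> is the ratio that
    the competitiveness hypothesis really speaks of.\<close>
  define \<beta> where "\<beta> = max 0 \<alpha>"
  have \<beta>: "0 \<le> \<beta>" "\<beta> < 1" "ennreal \<alpha> = ennreal \<beta>"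
    using \<open>\<not> 1 \<le> \<alpha>\<close> by (auto simp: \<beta>_def max_def ennreal_neg)
  \<comment> \<open>Solves K = \<beta> K + c + 1, which exceeds the allowed \<beta> K + c by
    1.\<close>
  define K where "K = (c + 1) / (1 - \<beta>)"
  have K: "0 \<le> K" "\<beta> * K + c < K"
  proof -
    have "K * (1 - \<beta>) = c + 1" using \<beta> by (simp add: K_def)
    then show "\<beta> * K + c < K" by (simp add: algebra_simps)
  qed (use \<beta> \<open>0 \<le> c\<close> in \<open>simp add: K_def\<close>)
  define ls where "ls = [restrict (\<lambda>_. ennreal K) M]"
  have ls: "ls \<in> cost_sequences M" by (simp add: ls_def cost_sequences_def)
  have "ennreal K \<le> mts_cost d x0 ls xs" if "xs \<in> set_pmf (run A ls)" for xs
  proof -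
    have "length xs = 1" "set xs \<subseteq> M"
      using that set_run_prefix_subset[OF A] set_run_prefix_length unfolding run_def ls_def by fastforce+
    then have "xs ! 0 \<in> M" by (auto dest: nth_mem)
    then show ?thesis by (simp add: mts_cost_def ls_def)
  qed
  then have "ennreal K \<le> expected_cost d x0 ls (run A ls)"
    unfolding expected_cost_def
    using nn_integral_mono_AE[of "\<lambda>_. ennreal K" "mts_cost d x0 ls" "measure_pmf (run A ls)"]
    by (simp add: AE_measure_pmf_iff)
  also have "\<dots> \<le> ennreal \<alpha> * offline_opt M d x0 ls + ennreal c"
    using comp ls by (simp add: competitive_with_constant_def)
  also have "\<dots> \<le> ennreal \<alpha> * ennreal K + ennreal c"
  proof (intro add_right_mono mult_left_mono)
    have "offline_opt M d x0 ls \<le> mts_cost d x0 ls [x0]"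
      unfolding offline_opt_def
      by (rule INF_lower) (simp add: state_sequences_def initial_state ls_def)
    also have "\<dots> = ennreal K" using initial_state by (simp add: mts_cost_def ls_def)
    finally show "offline_opt M d x0 ls \<le> ennreal K" .
  qed simp
  also have "\<dots> = ennreal (\<beta> * K + c)"
    using \<beta> K \<open>0 \<le> c\<close> by (simp add: ennreal_mult)
  finally have "K \<le> \<beta> * K + c"
    using \<beta> K \<open>0 \<le> c\<close> by (subst (asm) ennreal_le_iff) auto
  with K show False by simp
qed

lemma min_mult_of_bounds:
  fixes Off :: ennreal
  assumes "x \<le> a * Off + c" "y \<le> Off + e + D" "Off < \<infinity>"
  shows "min x y \<le> min a (1 + e / Off) * Off + (c + D)"
\<comment> \<open>Off = 0 joins the first case: the product with \<open>Off\<close> is then 0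
  whatever the quotient is, so only the bound on \<open>x\<close> can be used. Otherwise
  \<open>Off\<close> is positive and finite and cancels against the quotient.\<close>
proof (cases "a \<le> 1 + e / Off \<or> Off = 0")
  case True
  then have "min a (1 + e / Off) * Off = a * Off" by (auto simp: min_def)
  moreover have "min x y \<le> a * Off + c + D"
    using assms(1) by (simp add: min.coboundedI1 add_increasing2)
  ultimately show ?thesis by (simp add: add.assoc)
next
  case False
  then have "min a (1 + e / Off) * Off = (1 + e / Off) * Off" by (simp add: min_def)
  also have "\<dots> = Off + e"
    using False \<open>Off < \<infinity>\<close> by (simp add: distrib_right ennreal_divide_times ennreal_times_divide)
  finally have "min a (1 + e / Off) * Off = Off + e" .
  moreover have "min x y \<le> (Off + e + D) + c"
    using assms(2) by (simp add: min.coboundedI2 add_increasing2)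
  ultimately show ?thesis by (simp add: ac_simps)
qed

text \<open>Settles the two degenerate cases of the theorem: an offline sequence of infinite cost,
  and a space of diameter 0.\<close>

lemma robust_bound_ge_offline:
  assumes "1 \<le> \<alpha>" "0 \<le> \<epsilon>"
  shows "Off \<le> robust_bound \<epsilon> \<alpha> \<eta> Off"
proof -
  have "1 \<le> min (ennreal \<alpha>) (1 + ennreal (4 * \<eta>) / Off)" "1 \<le> ennreal (1 + \<epsilon>)"
    using assms by (auto simp flip: ennreal_1 intro: ennreal_leI simp del: ennreal_1)
  then have "1 * 1 * Off \<le> ennreal (1 + \<epsilon>) * min (ennreal \<alpha>) (1 + ennreal (4 * \<eta>) / Off) * Off"
    by (intro mult_mono) auto
  then show ?thesis by (simp add: robust_bound_def)
qed

lemma (in metrical_task_system) dist_le_diameter: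
  "mbounded M \<Longrightarrow> x \<in> M \<Longrightarrow> y \<in> M \<Longrightarrow> d x y \<le> mts_diameter M d"
proof -
  assume "mbounded M" and xy: "x \<in> M" "y \<in> M"
  then obtain K where "\<forall>x\<in>M. \<forall>y\<in>M. d x y \<le> K" by (auto simp: mbounded_alt)
  then have "bdd_above ((\<lambda>(x, y). d x y) ` (M \<times> M))" by (intro bdd_aboveI[of _ K]) auto
  then show "d x y \<le> mts_diameter M d"
    unfolding mts_diameter_def using cSUP_upper[of "(x, y)" "M \<times> M" "\<lambda>(x, y). d x y"] xy by simp
qed

(* C (c / D) is the factor hidden in O(D/\<epsilon>).  The additive constant c of the competitive algorithm
   has to be absorbed by that term; apart from the ratio c / D, the factor depends neither on the
   task system nor on A, \<alpha>, \<epsilon> or the input.  For D = 0 the whole term is 0. *)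
theorem theorem2:
  "\<exists>C :: real \<Rightarrow> real.
     \<forall>(M :: 'a set) d x0 D (A :: ('a \<Rightarrow> ennreal, 'a) randomized_algorithm) \<alpha> c \<epsilon>.
       metrical_task_system M d x0 \<longrightarrow>
       Metric_space.mbounded M d M \<longrightarrow>
       D = mts_diameter M d \<longrightarrow>
       online_algorithm M A \<longrightarrow>
       0 \<le> c \<longrightarrow> competitive_with_constant M d x0 A \<alpha> c \<longrightarrow>
       0 < \<epsilon> \<longrightarrow> \<epsilon> \<le> 1 / 4 \<longrightarrow>
       (\<exists>B :: (('a \<Rightarrow> ennreal) \<times> 'a, 'a) randomized_algorithm.
          online_algorithm M B \<and>
          (\<forall>ls \<in> cost_sequences M. \<forall>ps \<in> state_sequences M (length ls).
             \<forall>os \<in> state_sequences M (length ls).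
               expected_cost d x0 ls (run B (zip ls ps))
                 \<le> robust_bound \<epsilon> \<alpha> (prediction_error d ps os) (mts_cost d x0 ls os)
                   + ennreal (C (c / D) * (D / \<epsilon>))))"
\<comment> \<open>Times D/\<epsilon> this factor is (2c + 2D)/\<epsilon>. It has to cover (1 +
  \<epsilon>)(c + D + D/\<epsilon>), where c comes from \<open>A\<close>, D from the greedy slacks
  and D/\<epsilon> from the mixing.\<close>
proof (intro exI[of _ "\<lambda>r. 2 * r + 2"] allI impI)
  fix M :: "'a set" and d x0 D and A :: "('a \<Rightarrow> ennreal, 'a) randomized_algorithm"
    and \<alpha> c \<epsilon> :: real
  assume "metrical_task_system M d x0"
  then interpret metrical_task_system M d x0 .
  assume bdd: "mbounded M" and D: "D = mts_diameter M d" and A: "online_algorithm M A"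
    and "0 \<le> c" and comp: "competitive_with_constant M d x0 A \<alpha> c" and \<epsilon>: "0 < \<epsilon>" "\<epsilon> \<le> 1 / 4"
  let ?goal = "\<lambda>B ls ps os. expected_cost d x0 ls (run B (zip ls ps))
    \<le> robust_bound \<epsilon> \<alpha> (prediction_error d ps os) (mts_cost d x0 ls os)
      + ennreal ((2 * (c / D) + 2) * (D / \<epsilon>))"
  have bound: "d x y \<le> D" if "x \<in> M" "y \<in> M" for x y
    unfolding D using bdd that by (rule dist_le_diameter)
  have \<alpha>: "1 \<le> \<alpha>" using A comp \<open>0 \<le> c\<close> by (rule competitive_ratio_ge_1)
  consider "D = 0" | "0 < D" using bound[OF initial_state initial_state] initial_state by fastforce
  then show "\<exists>B. online_algorithm M B \<and> (\<forall>ls \<in> cost_sequences M.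
      \<forall>ps \<in> state_sequences M (length ls). \<forall>os \<in> state_sequences M (length ls). ?goal B ls ps os)"
  proof cases
    \<comment> \<open>The rate \<epsilon>/D is meaningless here and no additive term is allowed. But
      the space is a single point, so there is only one state sequence and its cost is that of
      \<open>os\<close>.\<close>
    assume "D = 0"
    have single: "x = x0" if "x \<in> M" for x
      using bound[OF that initial_state] nonneg[of x x0] zero[OF that initial_state] \<open>D = 0\<close> by linarith
    define B :: "(('a \<Rightarrow> ennreal) \<times> 'a, 'a) randomized_algorithm" where "B rs xs = return_pmf x0" for rs xs
    have B: "online_algorithm M B" by (simp add: B_def online_algorithm_def initial_state)
    have "?goal B ls ps os"
      if "ps \<in> state_sequences M (length ls)" "os \<in> state_sequences M (length ls)" for ls ps os
    proof -
      have "xs = os" if "xs \<in> set_pmf (run B (zip ls ps))" for xs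
      proof -
        have "length xs = length os" "set xs \<subseteq> M"
          using that set_run_prefix_length set_run_prefix_subset[OF B] unfolding run_def
          using \<open>ps \<in> _\<close> \<open>os \<in> _\<close> by (fastforce simp: state_sequences_def)+
        moreover have "set os \<subseteq> M" using \<open>os \<in> _\<close> by (auto simp: state_sequences_def)
        ultimately show ?thesis
          by (intro nth_equalityI) (metis, metis nth_mem single subset_iff)
      qed
      then have "expected_cost d x0 ls (run B (zip ls ps)) = (\<integral>\<^sup>+xs. mts_cost d x0 ls os \<partial>run B (zip ls ps))"
        unfolding expected_cost_def by (intro nn_integral_cong_AE) (auto simp: AE_measure_pmf_iff)
      also have "\<dots> = mts_cost d x0 ls os" by simp
      also have "\<dots> \<le> robust_bound \<epsilon> \<alpha> (prediction_error d ps os) (mts_cost d x0 ls os)"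
        using \<alpha> \<epsilon> by (intro robust_bound_ge_offline) auto
      finally show ?thesis by (rule order.trans) simp
    qed
    with B show ?thesis by blast
  next
    assume "0 < D"
    from robust_combination[OF A bound this \<epsilon>(1)]
    obtain B :: "(('a \<Rightarrow> ennreal) \<times> 'a, 'a) randomized_algorithm" where B: "online_algorithm M B"
      and cost_B: "\<And>ls ps. length ps = length ls \<Longrightarrow> expected_cost d x0 ls (run A ls) < \<infinity> \<Longrightarrow>
        mts_cost d x0 ls (follow_prediction M d D (zip ls ps)) < \<infinity> \<Longrightarrow>
        expected_cost d x0 ls (run B (zip ls ps))
          \<le> ennreal (1 + \<epsilon>) *
            (min (expected_cost d x0 ls (run A ls)) (mts_cost d x0 ls (follow_prediction M d D (zip ls ps)))
              + ennreal (D / \<epsilon>))"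
      by metis
    have "?goal B ls ps os"
      if ls: "ls \<in> cost_sequences M" and ps: "ps \<in> state_sequences M (length ls)"
        and os: "os \<in> state_sequences M (length ls)" for ls ps os
    proof (cases "mts_cost d x0 ls os = \<infinity>")
      \<comment> \<open>An infeasible offline sequence makes the bound infinite, because \<alpha> is
        at least 1.\<close>
      case True
      then show ?thesis
        using robust_bound_ge_offline[of \<alpha> \<epsilon> "\<infinity>" "prediction_error d ps os"] \<alpha> \<epsilon>
        by (simp add: top_unique)
    next
      case False
      let ?Off = "mts_cost d x0 ls os" and ?\<eta> = "prediction_error d ps os"
      let ?EA = "expected_cost d x0 ls (run A ls)"
      let ?EF = "mts_cost d x0 ls (follow_prediction M d D (zip ls ps))"
      let ?m = "min (ennreal \<alpha>) (1 + ennreal (4 * ?\<eta>) / ?Off) * ?Off"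
      have lists: "length ps = length ls" "length os = length ls" "set ps \<subseteq> M" "set os \<subseteq> M"
        using ps os by (auto simp: state_sequences_def in_lists_conv_set)
      have Off: "?Off < \<infinity>" using False by (simp add: less_top)
      have "?EA \<le> ennreal \<alpha> * offline_opt M d x0 ls + ennreal c"
        using comp ls by (simp add: competitive_with_constant_def)
      also have "\<dots> \<le> ennreal \<alpha> * ?Off + ennreal c"
        unfolding offline_opt_def using os by (intro add_right_mono mult_left_mono INF_lower) auto
      finally have EA: "?EA \<le> ennreal \<alpha> * ?Off + ennreal c" .
      have EF: "?EF \<le> ?Off + ennreal (4 * ?\<eta>) + ennreal D"
        using \<open>0 < D\<close> lists by (intro follow_prediction_cost)
      have "ennreal \<alpha> * ?Off + ennreal c < \<infinity>" "?Off + ennreal (4 * ?\<eta>) + ennreal D < \<infinity>"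
        using Off by (simp_all add: ennreal_mult_less_top)
      then have "expected_cost d x0 ls (run B (zip ls ps)) \<le> ennreal (1 + \<epsilon>) * (min ?EA ?EF + ennreal (D / \<epsilon>))"
        using EA EF lists by (intro cost_B) (auto intro: le_less_trans)
      also have "\<dots> \<le> ennreal (1 + \<epsilon>) * (?m + (ennreal c + ennreal D) + ennreal (D / \<epsilon>))"
        by (intro mult_left_mono add_right_mono min_mult_of_bounds EA EF Off) simp
      also have "\<dots> = robust_bound \<epsilon> \<alpha> ?\<eta> ?Off + ennreal ((1 + \<epsilon>) * (c + D + D / \<epsilon>))"
      proof -
        have "?m + (ennreal c + ennreal D) + ennreal (D / \<epsilon>) = ?m + ennreal (c + D + D / \<epsilon>)"
          using \<open>0 \<le> c\<close> \<open>0 < D\<close> \<epsilon> by (simp add: add.assoc)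
        moreover have "ennreal ((1 + \<epsilon>) * (c + D + D / \<epsilon>)) = ennreal (1 + \<epsilon>) * ennreal (c + D + D / \<epsilon>)"
          using \<open>0 \<le> c\<close> \<open>0 < D\<close> \<epsilon> by (intro ennreal_mult) auto
        ultimately show ?thesis by (simp only: robust_bound_def distrib_left mult.assoc)
      qed
      also have "\<dots> \<le> robust_bound \<epsilon> \<alpha> ?\<eta> ?Off + ennreal ((2 * (c / D) + 2) * (D / \<epsilon>))"
      proof (intro add_left_mono ennreal_leI)
        \<comment> \<open>Here \<epsilon> \<le> 1/4 absorbs the terms c and D, which carry no
          1/\<epsilon>, into the O(D/\<epsilon>) term.\<close>
        have "x \<le> x / 4 / \<epsilon>" if "0 \<le> x" for x
          using mult_left_mono[OF \<epsilon>(2) that] \<epsilon>(1) by (simp add: pos_le_divide_eq)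
        from this[of c] this[of D] have "c + D + D / \<epsilon> \<le> (c / 4 + 5 / 4 * D) / \<epsilon>"
          using \<open>0 \<le> c\<close> \<open>0 < D\<close> by (simp add: add_divide_distrib)
        then have "(1 + \<epsilon>) * (c + D + D / \<epsilon>) \<le> (5 / 4) * ((c / 4 + 5 / 4 * D) / \<epsilon>)"
          using \<epsilon> \<open>0 \<le> c\<close> \<open>0 < D\<close> by (intro mult_mono) auto
        also have "\<dots> \<le> (2 * c + 2 * D) / \<epsilon>"
          using \<epsilon> \<open>0 \<le> c\<close> \<open>0 < D\<close> by (simp add: field_simps)
        also have "\<dots> = (2 * (c / D) + 2) * (D / \<epsilon>)"
          using \<open>0 < D\<close> \<epsilon> by (simp add: field_simps)
        finally show "(1 + \<epsilon>) * (c + D + D / \<epsilon>) \<le> (2 * (c / D) + 2) * (D / \<epsilon>)" .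
      qed
      finally show ?thesis .
    qed
    with B show ?thesis by blast
  qed
qed

end
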